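(* Let $\mathcal D$ be an additive-noise system of causal SDEs, i.e. one given by $$X_V(t)=X^0_\alpha+\int_0^t\mu(s,X_V(s))\,\mathrm ds+\int_0^t\Sigma\,\mathrm dX_\gamma(s),\qquad t\in[0,T],$$ satisfying the additive-noise assumption described in the context. Then $\mathcal D$ satisfies the following two conditions: (i) for every strongly connected component $S$ of the causal graph $G(\mathcal D)$ and every $v\in S$, $\alpha(v)\cap S=\emptyset$; (ii) for every $v\in V$, writing $S_v$ for the strongly connected component of $G(\mathcal D)$ containing $v$, $g_v$ satisfies the linear-growth and Lipschitz conditions in $(X_v,X_{\beta(v)\cap S_v})$ given $X_{\beta(v)\setminus S_v}$.
   Context: Fix $T<\infty$ and a filtered probability space satisfying the usual conditions. $D([0,T],\mathbb R^n)$ denotes the càdlàg functions with the Skorokhod $J_1$ topology and Borel $\sigma$-algebra; $x^{\wedge t}(s):=x(s\wedge t)$. A measurable $f:[0,T]\times D([0,T],\mathbb R^m)\to\mathbb R^n$ is càdlàg if $t\mapsto f(t,x)$ is càdlàg for all $x$, and adapted if $f(t,x)=f(t,x^{\wedge t})$. System of causal SDEs: a tuple $\mathcal D=(V,W,X_W,f,g,h)$ with $V,W$ finite disjoint index sets, mutually independent real-valued semimartingales $X_w$ ($w\in W$), and for each $v\in V$ an equation $$X_v(t)=f_v(t,X_{\alpha(v)})+\int_0^t g_v(s-,X_v,X_{\beta(v)})\,\mathrm dh_v(s,X_{\gamma(v)}),\quad t\in[0,T],$$ with $\alpha(v)\subseteq V\cup W$, $\beta(v)\subseteq (V\cup W)\setminus\{v\}$,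 $\gamma(v)\subseteq W$, some $m_v\in\mathbb N\cup\{0\}$, and measurable càdlàg adapted $f_v$ (real-valued), $g_v,h_v$ ($\mathbb R^{m_v}$-valued) with $h_v(\cdot,X_{\gamma(v)})$ a semimartingale. Causal graph: $G(\mathcal D)$ has vertex set $V$; its directed edges are $u\to v$ ($u,v\in V$) whenever $u\in\alpha(v)$ and $f_v$ is not constant in $x_u$, or $u\in\{v\}\cup\beta(v)$ and $g_v$ is not constant in $x_u$ (it also has bidirected edges, irrelevant here). A strongly connected component is a maximal set of vertices any two of which are joined by directed paths in both directions. Linear-growth and Lipschitz conditions: a measurable $g:[0,T]\times D([0,T],\mathbb R^k)\times D([0,T],\mathbb R^\ell)\to\mathbb R^m$ satisfies these in $x$ given $y$ if there is a measurable càdlàg $K:[0,T]\times D([0,T],\mathbb R^\ell)\to(0,\infty)$ such that for all $x,x_1,x_2,y,t$: $\|g(t,x,y)\|\le K(t,y)(1+\sup_{0\le s\le t}\|x(s)\|)$ and $\|g(t,x_1,y)-g(t,x_2,y)\|\le K(t,y)\sup_{0\le s\le t}\|x_1(s)-x_2(s)\|$. Additive-noise assumption: $|V|=d$, $W=\alpha\cup\gamma$ with $\alpha,\gamma$ disjoint and $|\alpha|=|\gamma|=d$, $v\mapsto\alpha(v)$ a bijection of $V$ onto $\alpha$; $X^0_\alpha$ is a vector of mutually independent exogenous random variables with $\mathbb E[\|X^0_\alpha\|^2]<\infty$; $X_\gamma$ is a $d$-dimensional standard Brownian motion with independent components, independent of $X^0_\alpha$; the drift $\mu:[0,T]\times\mathbb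 R^d\to\mathbb R^d$ is such that $t\mapsto\mu(t,x_V(t))$ is continuous for continuous $x_V$, and $(t,x_V)\mapsto\mu(t,x_V(t))$ satisfies the linear-growth and Lipschitz conditions in $x_V$ (with $K=K(t)$); $\Sigma\in\mathbb R^{d\times d}$ is invertible. It is viewed as a system of causal SDEs by setting, for each $v\in V$ (with $\alpha(v)$ identified with the singleton containing it), $\beta(v)=V\setminus\{v\}$, $\gamma(v)=\{w\in\gamma:\Sigma_{vw}\ne0\}$, $f_v(t,X_{\alpha(v)})=X^0_{\alpha(v)}$, $g_v(s,X_v,X_{\beta(v)})=(\mu_v(s,X_V(s)),(\Sigma_{vw})_{w\in\gamma(v)})$ and $h_v(s,X_{\gamma(v)})=(s,X_{\gamma(v)}(s))$. *)

theory Defs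
  imports "HOL-Probability.Probability" "Graph_Theory.Graph_Theory"
begin

section \<open>Paths and the Skorokhod topology\<close>

text \<open>
  A vector in \<open>\<real>\<^sup>A\<close>, for a finite index set \<open>A\<close>, is a function on indices of which only the
  values on \<open>A\<close> matter; its Euclidean norm is \<open>L2_set x A\<close>.  An element of \<open>D([0,T], \<real>\<^sup>A)\<close> is a
  function of time and index that is undefined off \<open>[0,T]\<close> and off \<open>A\<close>, so that equality of
  paths is equality of functions.  If \<open>A\<close> is empty the path space is a single point.
\<close>

type_synonym 'i path = "real \<Rightarrow> 'i \<Rightarrow> real"

definition cadlag :: "real \<Rightarrow> (real \<Rightarrow> real) \<Rightarrow> bool" where
  "cadlag T x \<longleftrightarrow>
     (\<forall>t\<in>{0..<T}. (x \<longlongrightarrow> x t) (at_right t)) \<and> (\<forall>t\<in>{0<..T}. \<exists>l. (x \<longlongrightarrow> l) (at_left t))"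

definition path_space :: "real \<Rightarrow> 'i set \<Rightarrow> 'i path set" where
  "path_space T A =
     {x \<in> {0..T} \<rightarrow>\<^sub>E (A \<rightarrow>\<^sub>E UNIV). \<forall>i\<in>A. cadlag T (\<lambda>t. x t i)}"

definition time_changes :: "real \<Rightarrow> (real \<Rightarrow> real) set" where
  "time_changes T = {\<tau>. bij_betw \<tau> {0..T} {0..T} \<and> strict_mono_on {0..T} \<tau>}"

definition skorokhod_ball :: "real \<Rightarrow> 'i set \<Rightarrow> 'i path \<Rightarrow> real \<Rightarrow> 'i path set" where
  "skorokhod_ball T A x e =
     {y \<in> path_space T A. \<exists>\<tau>\<in>time_changes T. \<forall>t\<in>{0..T}.
        \<bar>\<tau> t - t\<bar> < e \<and> L2_set (\<lambda>i. x t i - y (\<tau> t) i) A < e}"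

definition skorokhod_topology :: "real \<Rightarrow> 'i set \<Rightarrow> 'i path topology" where
  "skorokhod_topology T A =
     topology (\<lambda>U. U \<subseteq> path_space T A \<and> (\<forall>x\<in>U. \<exists>e>0. skorokhod_ball T A x e \<subseteq> U))"

lemma openin_skorokhod_topology:
  "openin (skorokhod_topology T A) U \<longleftrightarrow>
     U \<subseteq> path_space T A \<and> (\<forall>x\<in>U. \<exists>e>0. skorokhod_ball T A x e \<subseteq> U)"
proof -
  let ?L = "\<lambda>U. U \<subseteq> path_space T A \<and> (\<forall>x\<in>U. \<exists>e>0. skorokhod_ball T A x e \<subseteq> U)"
  have mono: "skorokhod_ball T A x d \<subseteq> skorokhod_ball T A x e" if "d \<le> e" for x d e
    using that unfolding skorokhod_ball_def by (blast intro: less_le_trans)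
  have "istopology ?L"
    unfolding istopology_def
  proof (intro conjI allI impI)
    fix U V assume U: "?L U" and V: "?L V"
    show "U \<inter> V \<subseteq> path_space T A" using U by blast
    show "\<forall>x\<in>U \<inter> V. \<exists>e>0. skorokhod_ball T A x e \<subseteq> U \<inter> V"
    proof
      fix x assume "x \<in> U \<inter> V"
      then obtain d e where "d > 0" "skorokhod_ball T A x d \<subseteq> U"
        "e > 0" "skorokhod_ball T A x e \<subseteq> V" using U V by blast
      then show "\<exists>e>0. skorokhod_ball T A x e \<subseteq> U \<inter> V"
        using mono[of "min d e" d x] mono[of "min d e" e x] by (intro exI[of _ "min d e"]) auto
    qed
  next
    fix K assume K: "\<forall>U\<in>K. ?L U"
    show "\<Union>K \<subseteq> path_space T A" using K by blast
    show "\<forall>x\<in>\<Union>K. \<exists>e>0. skorokhod_ball T A x e \<subseteq> \<Union>K" using K by (meson Union_iff Union_upper order_trans)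
  qed
  then show ?thesis unfolding skorokhod_topology_def by (simp add: topology_inverse')
qed

definition skorokhod_borel :: "real \<Rightarrow> 'i set \<Rightarrow> 'i path measure" where
  "skorokhod_borel T A = sigma (path_space T A) {U. openin (skorokhod_topology T A) U}"

definition stop_path :: "real \<Rightarrow> 'i path \<Rightarrow> real \<Rightarrow> 'i path" where
  "stop_path T x t = (\<lambda>s\<in>{0..T}. x (min s t))"

definition merge_paths :: "real \<Rightarrow> 'i set \<Rightarrow> 'i set \<Rightarrow> 'i path \<Rightarrow> 'i path \<Rightarrow> 'i path" where
  "merge_paths T A B x y = (\<lambda>t\<in>{0..T}. merge A B (x t, y t))"


section \<open>Functionals on path space\<close>

definition measurable_functional :: "real \<Rightarrow> 'i set \<Rightarrow> (real \<Rightarrow> 'i path \<Rightarrow> real) \<Rightarrow> bool" where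
  "measurable_functional T A f \<longleftrightarrow>
     (\<lambda>(t, x). f t x) \<in> borel_measurable (restrict_space borel {0..T} \<Otimes>\<^sub>M skorokhod_borel T A)"

definition cadlag_functional :: "real \<Rightarrow> 'i set \<Rightarrow> (real \<Rightarrow> 'i path \<Rightarrow> real) \<Rightarrow> bool" where
  "cadlag_functional T A f \<longleftrightarrow> (\<forall>x\<in>path_space T A. cadlag T (\<lambda>t. f t x))"

definition adapted_functional :: "real \<Rightarrow> 'i set \<Rightarrow> (real \<Rightarrow> 'i path \<Rightarrow> real) \<Rightarrow> bool" where
  "adapted_functional T A f \<longleftrightarrow>
     (\<forall>x\<in>path_space T A. \<forall>t\<in>{0..T}. f t x = f t (stop_path T x t))"

definition causal_functional :: "real \<Rightarrow> 'i set \<Rightarrow> (real \<Rightarrow> 'i path \<Rightarrow> real) \<Rightarrow> bool" where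
  "causal_functional T A f \<longleftrightarrow>
     measurable_functional T A f \<and> cadlag_functional T A f \<and> adapted_functional T A f"

definition constant_in ::
    "real \<Rightarrow> 'i set \<Rightarrow> 'i \<Rightarrow> (real \<Rightarrow> 'i path \<Rightarrow> real) \<Rightarrow> bool" where
  "constant_in T A u f \<longleftrightarrow>
     (\<forall>t\<in>{0..T}. \<forall>x\<in>path_space T A. \<forall>x'\<in>path_space T A.
        (\<forall>s\<in>{0..T}. \<forall>i\<in>A - {u}. x s i = x' s i) \<longrightarrow> f t x = f t x')"

text \<open>
  Growth and Lipschitz conditions in \<open>x \<in> D([0,T], \<real>\<^sup>A)\<close> given \<open>y \<in> D([0,T], \<real>\<^sup>B)\<close>, for a
  measurable \<open>\<real>\<^sup>J\<close>-valued functional.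
\<close>

definition linear_growth_lipschitz ::
    "real \<Rightarrow> 'i set \<Rightarrow> 'i set \<Rightarrow> 'k set \<Rightarrow> (real \<Rightarrow> 'i path \<Rightarrow> 'i path \<Rightarrow> 'k \<Rightarrow> real) \<Rightarrow> bool" where
  "linear_growth_lipschitz T A B J g \<longleftrightarrow>
     (\<forall>j\<in>J. (\<lambda>(t, x, y). g t x y j) \<in> borel_measurable
        (restrict_space borel {0..T} \<Otimes>\<^sub>M (skorokhod_borel T A \<Otimes>\<^sub>M skorokhod_borel T B))) \<and>
     (\<exists>K. measurable_functional T B K \<and> cadlag_functional T B K \<and>
        (\<forall>t\<in>{0..T}. \<forall>y\<in>path_space T B. 0 < K t y) \<and>
        (\<forall>t\<in>{0..T}. \<forall>y\<in>path_space T B. \<forall>x\<in>path_space T A.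
           L2_set (g t x y) J \<le> K t y * (1 + (SUP s\<in>{0..t}. L2_set (x s) A))) \<and>
        (\<forall>t\<in>{0..T}. \<forall>y\<in>path_space T B. \<forall>x\<^sub>1\<in>path_space T A. \<forall>x\<^sub>2\<in>path_space T A.
           L2_set (\<lambda>j. g t x\<^sub>1 y j - g t x\<^sub>2 y j) J
             \<le> K t y * (SUP s\<in>{0..t}. L2_set (\<lambda>i. x\<^sub>1 s i - x\<^sub>2 s i) A)))"


section \<open>Filtered probability spaces and semimartingales\<close>

text \<open>
  Only the part of the filtration indexed by \<open>[0,T]\<close> plays a role; a filtration on \<open>[0,T]\<close> is
  extended to the real line by its values at \<open>0\<close> and \<open>T\<close>.
\<close>

locale filtered_prob_space = prob_space M + filtration "space M" F
  for M :: "'w measure" and F :: "real \<Rightarrow> 'w measure" +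
  fixes T :: real
  assumes horizon_nonneg: "0 \<le> T"
    and sets_F_subset: "\<And>t. t \<in> {0..T} \<Longrightarrow> sets (F t) \<subseteq> sets M"
    and F_right_continuous: "\<And>t. t \<in> {0..<T} \<Longrightarrow> sets (F t) = (\<Inter>s\<in>{t<..T}. sets (F s))"
    and F_complete: "\<And>N A. N \<in> null_sets M \<Longrightarrow> A \<subseteq> N \<Longrightarrow> A \<in> sets (F 0)"
begin

definition cadlag_adapted :: "(real \<Rightarrow> 'w \<Rightarrow> real) \<Rightarrow> bool" where
  "cadlag_adapted Y \<longleftrightarrow>
     (\<forall>t\<in>{0..T}. Y t \<in> borel_measurable (F t)) \<and> (\<forall>\<omega>\<in>space M. cadlag T (\<lambda>t. Y t \<omega>))"

definition martingale :: "(real \<Rightarrow> 'w \<Rightarrow> real) \<Rightarrow> bool" where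
  "martingale Y \<longleftrightarrow>
     (\<forall>t\<in>{0..T}. Y t \<in> borel_measurable (F t) \<and> integrable M (Y t)) \<and>
     (\<forall>s\<in>{0..T}. \<forall>t\<in>{s..T}. AE \<omega> in M. real_cond_exp M (F s) (Y t) \<omega> = Y s \<omega>)"

text \<open>On a compact time interval a localizing sequence reaches the horizon almost surely.\<close>

definition local_martingale :: "(real \<Rightarrow> 'w \<Rightarrow> real) \<Rightarrow> bool" where
  "local_martingale Y \<longleftrightarrow> cadlag_adapted Y \<and>
     (\<exists>\<tau> :: nat \<Rightarrow> 'w \<Rightarrow> real.
        (\<forall>n. stopping_time F (\<tau> n)) \<and>
        (\<forall>n. \<forall>\<omega>\<in>space M. \<tau> n \<omega> \<in> {0..T} \<and> \<tau> n \<omega> \<le> \<tau> (Suc n) \<omega>) \<and>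
        (AE \<omega> in M. \<exists>n. \<tau> n \<omega> = T) \<and>
        (\<forall>n. martingale (\<lambda>t \<omega>. Y (min t (\<tau> n \<omega>)) \<omega> - Y 0 \<omega>)))"

definition finite_variation_process :: "(real \<Rightarrow> 'w \<Rightarrow> real) \<Rightarrow> bool" where
  "finite_variation_process Y \<longleftrightarrow> cadlag_adapted Y \<and>
     (\<forall>\<omega>\<in>space M. \<exists>C. \<forall>n. \<forall>p :: nat \<Rightarrow> real.
        (\<forall>i\<le>n. p i \<in> {0..T}) \<and> (\<forall>i<n. p i \<le> p (Suc i)) \<longrightarrow>
        (\<Sum>i<n. \<bar>Y (p (Suc i)) \<omega> - Y (p i) \<omega>\<bar>) \<le> C)"

definition semimartingale :: "(real \<Rightarrow> 'w \<Rightarrow> real) \<Rightarrow> bool" where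
  "semimartingale Y \<longleftrightarrow> cadlag_adapted Y \<and>
     (\<exists>N A. local_martingale N \<and> finite_variation_process A \<and>
        (\<forall>t\<in>{0..T}. \<forall>\<omega>\<in>space M. Y t \<omega> = N t \<omega> + A t \<omega>))"

text \<open>Independence of two random variables with values in possibly different types.\<close>

definition independent ::
    "'b measure \<Rightarrow> ('w \<Rightarrow> 'b) \<Rightarrow> 'c measure \<Rightarrow> ('w \<Rightarrow> 'c) \<Rightarrow> bool" where
  "independent N Y N' Z \<longleftrightarrow> random_variable N Y \<and> random_variable N' Z \<and>
     indep_set (sets (vimage_algebra (space M) Y N)) (sets (vimage_algebra (space M) Z N'))"

definition standard_brownian_motion :: "(real \<Rightarrow> 'w \<Rightarrow> real) \<Rightarrow> bool" where
  "standard_brownian_motion B \<longleftrightarrow>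
     (\<forall>t\<in>{0..T}. random_variable borel (B t)) \<and>
     (AE \<omega> in M. B 0 \<omega> = 0 \<and> continuous_on {0..T} (\<lambda>t. B t \<omega>)) \<and>
     (\<forall>s\<in>{0..T}. \<forall>t\<in>{s<..T}.
        distributed M lborel (\<lambda>\<omega>. B t \<omega> - B s \<omega>) (normal_density 0 (sqrt (t - s))) \<and>
        independent borel (\<lambda>\<omega>. B t \<omega> - B s \<omega>)
          (PiM {0..s} (\<lambda>_. borel)) (\<lambda>\<omega>. \<lambda>u\<in>{0..s}. B u \<omega>))"

end


section \<open>Systems of causal SDEs\<close>

text \<open>
  The tuple \<open>(V, W, X\<^sub>W, f, g, h)\<close> together with the argument sets \<open>\<alpha>\<close>, \<open>\<beta>\<close>, \<open>\<gamma>\<close>.  The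
  integrand and integrator of the equation of \<open>v\<close> take values in \<open>\<real>\<close> to the power of the
  finite set \<open>coords v\<close>, whose cardinality is \<open>m\<^sub>v\<close>.  The argument \<open>(X\<^sub>v, X\<^bsub>\<beta>(v)\<^esub>)\<close> of the
  integrand is one path indexed by \<open>insert v (\<beta> v)\<close>.  The processes \<open>X\<^sub>V\<close> are the unknowns of
  the equations and not part of the tuple.
\<close>

record ('i, 'k, 'w) causal_sde =
  endo :: "'i set"
  exo :: "'i set"
  noise :: "'i \<Rightarrow> real \<Rightarrow> 'w \<Rightarrow> real"
  alpha :: "'i \<Rightarrow> 'i set"
  beta :: "'i \<Rightarrow> 'i set"
  gamma :: "'i \<Rightarrow> 'i set"
  coords :: "'i \<Rightarrow> 'k set"
  forcing :: "'i \<Rightarrow> real \<Rightarrow> 'i path \<Rightarrow> real"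
  integrand :: "'i \<Rightarrow> real \<Rightarrow> 'i path \<Rightarrow> 'k \<Rightarrow> real"
  integrator :: "'i \<Rightarrow> real \<Rightarrow> 'i path \<Rightarrow> 'k \<Rightarrow> real"

definition noise_path ::
    "real \<Rightarrow> ('i, 'k, 'w) causal_sde \<Rightarrow> 'i set \<Rightarrow> 'w \<Rightarrow> 'i path" where
  "noise_path T D A \<omega> = (\<lambda>t\<in>{0..T}. \<lambda>w\<in>A. noise D w t \<omega>)"

locale causal_sde_system = filtered_prob_space M F T
  for M :: "'w measure" and F :: "real \<Rightarrow> 'w measure" and T :: real +
  fixes D :: "('i, 'k, 'w) causal_sde"
  assumes finite_endo: "finite (endo D)"
    and finite_exo: "finite (exo D)"
    and endo_exo_disjoint: "endo D \<inter> exo D = {}"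
    and noise_semimartingale: "\<And>w. w \<in> exo D \<Longrightarrow> semimartingale (noise D w)"
    and noise_independent:
      "indep_vars (\<lambda>_. PiM {0..T} (\<lambda>_. borel)) (\<lambda>w \<omega>. \<lambda>t\<in>{0..T}. noise D w t \<omega>) (exo D)"
    and alpha_subset: "\<And>v. v \<in> endo D \<Longrightarrow> alpha D v \<subseteq> endo D \<union> exo D"
    and beta_subset: "\<And>v. v \<in> endo D \<Longrightarrow> beta D v \<subseteq> (endo D \<union> exo D) - {v}"
    and gamma_subset: "\<And>v. v \<in> endo D \<Longrightarrow> gamma D v \<subseteq> exo D"
    and finite_coords: "\<And>v. v \<in> endo D \<Longrightarrow> finite (coords D v)"
    and forcing_causal: "\<And>v. v \<in> endo D \<Longrightarrow> causal_functional T (alpha D v) (forcing D v)"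
    and integrand_causal: "\<And>v j. v \<in> endo D \<Longrightarrow> j \<in> coords D v \<Longrightarrow>
      causal_functional T (insert v (beta D v)) (\<lambda>t x. integrand D v t x j)"
    and integrator_causal: "\<And>v j. v \<in> endo D \<Longrightarrow> j \<in> coords D v \<Longrightarrow>
      causal_functional T (gamma D v) (\<lambda>t x. integrator D v t x j)"
    and integrator_semimartingale: "\<And>v j. v \<in> endo D \<Longrightarrow> j \<in> coords D v \<Longrightarrow>
      semimartingale (\<lambda>t \<omega>. integrator D v t (noise_path T D (gamma D v) \<omega>) j)"

text \<open>The directed edges of the causal graph; its bidirected edges do not affect components.\<close>

definition causal_edge :: "real \<Rightarrow> ('i, 'k, 'w) causal_sde \<Rightarrow> 'i \<Rightarrow> 'i \<Rightarrow> bool" where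
  "causal_edge T D u v \<longleftrightarrow> u \<in> endo D \<and> v \<in> endo D \<and>
     (u \<in> alpha D v \<and> \<not> constant_in T (alpha D v) u (forcing D v) \<or>
      u \<in> insert v (beta D v) \<and>
        (\<exists>j\<in>coords D v. \<not> constant_in T (insert v (beta D v)) u (\<lambda>t x. integrand D v t x j)))"

definition causal_graph :: "real \<Rightarrow> ('i, 'k, 'w) causal_sde \<Rightarrow> ('i, 'i \<times> 'i) pre_digraph" where
  "causal_graph T D =
     \<lparr>verts = endo D, arcs = {(u, v). causal_edge T D u v}, tail = fst, head = snd\<rparr>"

abbreviation causal_components :: "real \<Rightarrow> ('i, 'k, 'w) causal_sde \<Rightarrow> 'i set set" where
  "causal_components T D \<equiv> verts ` pre_digraph.sccs (causal_graph T D)"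

definition component_of :: "real \<Rightarrow> ('i, 'k, 'w) causal_sde \<Rightarrow> 'i \<Rightarrow> 'i set" where
  "component_of T D v = (THE S. S \<in> causal_components T D \<and> v \<in> S)"

lemma component_of_eq_scc_of:
  assumes "v \<in> endo D"
  shows "component_of T D v = pre_digraph.scc_of (causal_graph T D) v"
    and "component_of T D v \<in> causal_components T D"
    and "v \<in> component_of T D v"
proof -
  interpret G: wf_digraph "causal_graph T D"
    by unfold_locales (auto simp: causal_graph_def causal_edge_def)
  have v: "v \<in> verts (causal_graph T D)" using assms by (simp add: causal_graph_def)
  have S: "G.scc_of v \<in> causal_components T D" "v \<in> G.scc_of v"
    using G.scc_of_in_sccs_verts[OF v] G.in_scc_of_self[OF v] by (simp_all add: G.sccs_verts_conv)
  have "(THE S. S \<in> causal_components T D \<and> v \<in> S) = G.scc_of v"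
    using S G.sccs_verts_disjoint[of _ "G.scc_of v"]
    unfolding G.sccs_verts_conv by (intro the_equality) blast+
  then show "component_of T D v = G.scc_of v" unfolding component_of_def .
  with S show "component_of T D v \<in> causal_components T D" "v \<in> component_of T D v" by simp_all
qed


section \<open>Additive noise\<close>

text \<open>
  The sets \<open>\<alpha>\<close> and \<open>\<gamma>\<close> of exogenous indices are \<open>I\<close> and \<open>B\<close>, the bijection \<open>v \<mapsto> \<alpha>(v)\<close> is \<open>a\<close>, and
  the matrix \<open>\<Sigma>\<close> is \<open>Q\<close>, with rows indexed by the endogenous variables and columns by \<open>B\<close>.
  Coordinate \<open>None\<close> of integrand and integrator is the time coordinate.  Since \<open>D([0,T], \<real>\<^sup>{})\<close> is
  a single point, the growth bound of the drift depends on time only.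
\<close>

locale additive_noise_system = causal_sde_system M F T D
  for M :: "'w measure" and F :: "real \<Rightarrow> 'w measure" and T :: real
    and D :: "('i, 'i option, 'w) causal_sde" +
  fixes d :: nat
    and I B :: "'i set"
    and a :: "'i \<Rightarrow> 'i"
    and X0 :: "'i \<Rightarrow> 'w \<Rightarrow> real"
    and \<mu> :: "real \<Rightarrow> ('i \<Rightarrow> real) \<Rightarrow> 'i \<Rightarrow> real"
    and Q :: "'i \<Rightarrow> 'i \<Rightarrow> real"
  assumes card_endo: "card (endo D) = d"
    and exo_eq: "exo D = I \<union> B"
    and I_B_disjoint: "I \<inter> B = {}"
    and card_I: "card I = d"
    and card_B: "card B = d"
    and a_bij: "bij_betw a (endo D) I"
    and X0_independent: "indep_vars (\<lambda>_. borel) X0 I"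
    and X0_square_integrable: "integrable M (\<lambda>\<omega>. (L2_set (\<lambda>u. X0 u \<omega>) I)\<^sup>2)"
    and brownian: "\<And>w. w \<in> B \<Longrightarrow> standard_brownian_motion (noise D w)"
    and brownian_independent:
      "indep_vars (\<lambda>_. PiM {0..T} (\<lambda>_. borel)) (\<lambda>w \<omega>. \<lambda>t\<in>{0..T}. noise D w t \<omega>) B"
    and X0_brownian_independent:
      "independent (PiM I (\<lambda>_. borel)) (\<lambda>\<omega>. \<lambda>u\<in>I. X0 u \<omega>)
         (PiM B (\<lambda>_. PiM {0..T} (\<lambda>_. borel))) (\<lambda>\<omega>. \<lambda>w\<in>B. \<lambda>t\<in>{0..T}. noise D w t \<omega>)"
    and drift_continuous: "\<And>x. x \<in> path_space T (endo D) \<Longrightarrow>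
      (\<forall>v\<in>endo D. continuous_on {0..T} (\<lambda>t. x t v)) \<Longrightarrow>
      (\<forall>v\<in>endo D. continuous_on {0..T} (\<lambda>t. \<mu> t (x t) v))"
    and drift_lipschitz:
      "linear_growth_lipschitz T (endo D) {} (endo D) (\<lambda>t x y. \<mu> t (x t))"
    and Q_invertible: "\<exists>R. (\<forall>v\<in>endo D. \<forall>v'\<in>endo D.
        (\<Sum>w\<in>B. Q v w * R w v') = (if v = v' then 1 else 0)) \<and>
      (\<forall>w\<in>B. \<forall>w'\<in>B. (\<Sum>v\<in>endo D. R w v * Q v w') = (if w = w' then 1 else 0))"
    and noise_I: "\<And>u t \<omega>. u \<in> I \<Longrightarrow> t \<in> {0..T} \<Longrightarrow> \<omega> \<in> space M \<Longrightarrow> noise D u t \<omega> = X0 u \<omega>"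
    and alpha_eq: "\<And>v. v \<in> endo D \<Longrightarrow> alpha D v = {a v}"
    and beta_eq: "\<And>v. v \<in> endo D \<Longrightarrow> beta D v = endo D - {v}"
    and gamma_eq: "\<And>v. v \<in> endo D \<Longrightarrow> gamma D v = {w \<in> B. Q v w \<noteq> 0}"
    and coords_eq: "\<And>v. v \<in> endo D \<Longrightarrow> coords D v = insert None (Some ` gamma D v)"
    and forcing_eq: "\<And>v t \<omega>. v \<in> endo D \<Longrightarrow> t \<in> {0..T} \<Longrightarrow> \<omega> \<in> space M \<Longrightarrow>
      forcing D v t (noise_path T D (alpha D v) \<omega>) = X0 (a v) \<omega>"
    and integrand_None: "\<And>v t x. v \<in> endo D \<Longrightarrow> t \<in> {0..T} \<Longrightarrow>
      x \<in> path_space T (insert v (beta D v)) \<Longrightarrow> integrand D v t x None = \<mu> t (x t) v"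
    and integrand_Some: "\<And>v t x w. v \<in> endo D \<Longrightarrow> t \<in> {0..T} \<Longrightarrow>
      x \<in> path_space T (insert v (beta D v)) \<Longrightarrow> w \<in> gamma D v \<Longrightarrow>
      integrand D v t x (Some w) = Q v w"
    and integrator_None: "\<And>v t x. v \<in> endo D \<Longrightarrow> t \<in> {0..T} \<Longrightarrow>
      x \<in> path_space T (gamma D v) \<Longrightarrow> integrator D v t x None = t"
    and integrator_Some: "\<And>v t x w. v \<in> endo D \<Longrightarrow> t \<in> {0..T} \<Longrightarrow>
      x \<in> path_space T (gamma D v) \<Longrightarrow> w \<in> gamma D v \<Longrightarrow>
      integrator D v t x (Some w) = x t w"

end

theory Submission
  imports Defs
begin

text \<open>
  The drift at time \<open>t\<close> depends on the path only through its value at \<open>t\<close>.  Testing the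
  hypotheses on constant paths therefore yields a jointly measurable map \<open>(t, z) \<mapsto> \<mu> t z\<close> with
  pointwise bounds \<open>\<bar>\<mu> t z\<bar> \<le> K t * (1 + \<bar>z\<bar>)\<close> and \<open>\<bar>\<mu> t z - \<mu> t z'\<bar> \<le> K t * \<bar>z - z'\<bar>\<close>.  Splitting
  \<open>z\<close> into the coordinates inside and outside the component, one may take
  \<open>K t * (1 + \<bar>y t\<bar>)\<close> plus a bound for the row of \<open>\<Sigma>\<close> as growth functional.
\<close>

section \<open>Cadlag functions: closure properties and boundedness\<close>

text \<open>The one-sided limits in \<open>cadlag\<close> are taken only on sides where points of
  \<open>[0,T]\<close> accumulate, so they ignore values elsewhere. This matters because paths are
  undefined off \<open>[0,T]\<close>.\<close>

lemma cadlag_cong: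
  assumes "\<And>t. t \<in> {0..T} \<Longrightarrow> x t = y t"
  shows "cadlag T x \<longleftrightarrow> cadlag T y"
proof -
  have r: "(x \<longlongrightarrow> x t) (at_right t) \<longleftrightarrow> (y \<longlongrightarrow> y t) (at_right t)" if "t \<in> {0..<T}" for t
  proof -
    have "\<forall>\<^sub>F s in at_right t. s \<in> {t<..<T}"
      using that by (intro eventually_at_right_real) auto
    then have "\<forall>\<^sub>F s in at_right t. x s = y s"
      by eventually_elim (use that assms in auto)
    moreover have "x t = y t" using that assms by auto
    ultimately show ?thesis by (simp add: filterlim_cong)
  qed
  have l: "(x \<longlongrightarrow> l) (at_left t) \<longleftrightarrow> (y \<longlongrightarrow> l) (at_left t)" if "t \<in> {0<..T}" for t l
  proof -
    have "\<forall>\<^sub>F s in at_left t. s \<in> {0<..<t}"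
      using that by (intro eventually_at_left_real) auto
    then have "\<forall>\<^sub>F s in at_left t. x s = y s"
      by eventually_elim (use that assms in auto)
    then show ?thesis by (simp add: filterlim_cong)
  qed
  show ?thesis unfolding cadlag_def using r l by blast
qed

lemma cadlag_const: "cadlag T (\<lambda>_. c)"
  unfolding cadlag_def by auto

lemma cadlag_add: "cadlag T x \<Longrightarrow> cadlag T y \<Longrightarrow> cadlag T (\<lambda>t. x t + y t)"
  unfolding cadlag_def by (blast intro: tendsto_add)

lemma cadlag_mult: "cadlag T x \<Longrightarrow> cadlag T y \<Longrightarrow> cadlag T (\<lambda>t. x t * y t)"
  for x y :: "real \<Rightarrow> real"
  unfolding cadlag_def by (blast intro: tendsto_mult)

lemma cadlag_sum:
  assumes "\<And>i. i \<in> A \<Longrightarrow> cadlag T (\<lambda>t. x t i)"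
  shows "cadlag T (\<lambda>t. \<Sum>i\<in>A. x t i)"
  using assms by (induction A rule: infinite_finite_induct) (simp_all add: cadlag_const cadlag_add)

lemma cadlag_sqrt: "cadlag T x \<Longrightarrow> cadlag T (\<lambda>t. sqrt (x t))"
  unfolding cadlag_def by (blast intro: tendsto_real_sqrt)

lemma cadlag_L2_set:
  assumes "\<And>i. i \<in> A \<Longrightarrow> cadlag T (\<lambda>t. x t i)"
  shows "cadlag T (\<lambda>t. L2_set (x t) A)"
  unfolding L2_set_def power2_eq_square by (intro cadlag_sqrt cadlag_sum cadlag_mult assms)

text \<open>A one-sided limit bounds \<open>x\<close> on a one-sided punctured neighbourhood. The
  two sides and the value at \<open>t\<close> give local boundedness, and compactness of
  \<open>[0,T]\<close> makes it global.\<close>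

lemma cadlag_bounded:
  assumes "cadlag T x"
  shows "bounded (x ` {0..T})"
proof -
  have "\<exists>U. open U \<and> t \<in> U \<and> bounded (x ` (U \<inter> {0..T}))" if t: "t \<in> {0..T}" for t
  proof -
    have near: "\<exists>d>0. \<exists>c. \<forall>s\<in>S. s \<noteq> t \<and> dist s t < d \<longrightarrow> \<bar>x s\<bar> \<le> c"
      if "(x \<longlongrightarrow> l) (at t within S)" for l S
    proof -
      have "\<forall>\<^sub>F s in at t within S. dist (x s) l < 1"
        using that by (rule tendstoD) simp
      then obtain d where "d > 0" "\<forall>s\<in>S. s \<noteq> t \<and> dist s t < d \<longrightarrow> dist (x s) l < 1"
        by (auto simp: eventually_at)
      then show ?thesis
        by (intro exI[of _ d] conjI exI[of _ "\<bar>l\<bar> + 1"]) (force simp: dist_real_def)+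
    qed
    \<comment> \<open>At \<open>t = T\<close> no point of \<open>[0,T]\<close> lies to the right, so
      any radius serves; likewise on the left at \<open>t = 0\<close> below.\<close>
    have "\<exists>d>0. \<exists>c. \<forall>s\<in>{0..T}. t < s \<and> dist s t < d \<longrightarrow> \<bar>x s\<bar> \<le> c"
    proof (cases "t < T")
      case True
      then have "(x \<longlongrightarrow> x t) (at_right t)" using assms t by (auto simp: cadlag_def)
      from near[OF this] show ?thesis by (metis greaterThan_iff less_irrefl)
    qed (auto intro!: exI[of _ 1])
    then obtain d c where d: "d > 0" "\<And>s. s \<in> {0..T} \<Longrightarrow> t < s \<Longrightarrow> dist s t < d \<Longrightarrow> \<bar>x s\<bar> \<le> c"
      by blast
    have "\<exists>d>0. \<exists>c. \<forall>s\<in>{0..T}. s < t \<and> dist s t < d \<longrightarrow> \<bar>x s\<bar> \<le> c"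
    proof (cases "0 < t")
      case True
      then obtain l where "(x \<longlongrightarrow> l) (at_left t)"
        using assms t unfolding cadlag_def by (meson atLeastAtMost_iff greaterThanAtMost_iff)
      from near[OF this] show ?thesis by (metis lessThan_iff less_irrefl)
    qed (auto intro!: exI[of _ 1])
    then obtain d' c' where d': "d' > 0"
      "\<And>s. s \<in> {0..T} \<Longrightarrow> s < t \<Longrightarrow> dist s t < d' \<Longrightarrow> \<bar>x s\<bar> \<le> c'"
      by blast
    have "\<bar>x s\<bar> \<le> max (max c c') \<bar>x t\<bar>" if "s \<in> ball t (min d d') \<inter> {0..T}" for s
      using d(2)[of s] d'(2)[of s] that
      by (cases s t rule: linorder_cases) (auto simp: dist_commute le_max_iff_disj)
    then have "bounded (x ` (ball t (min d d') \<inter> {0..T}))"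
      unfolding bounded_iff by (intro exI[of _ "max (max c c') \<bar>x t\<bar>"]) auto
    then show ?thesis
      using d(1) d'(1) by (intro exI[of _ "ball t (min d d')"]) auto
  qed
  then obtain U where U: "\<And>t. t \<in> {0..T} \<Longrightarrow> open (U t)" "\<And>t. t \<in> {0..T} \<Longrightarrow> t \<in> U t"
    "\<And>t. t \<in> {0..T} \<Longrightarrow> bounded (x ` (U t \<inter> {0..T}))" by metis
  have cover: "{0..T} \<subseteq> (\<Union>t\<in>{0..T}. U t)" using U(2) by blast
  obtain J where J: "J \<subseteq> {0..T}" "finite J" "{0..T} \<subseteq> (\<Union>t\<in>J. U t)"
    by (rule compactE_image[OF compact_Icc U(1) cover])
  have "x ` {0..T} \<subseteq> (\<Union>t\<in>J. x ` (U t \<inter> {0..T}))" using J(3) by blast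
  then show ?thesis
    by (rule bounded_subset[rotated]) (use J U(3) in \<open>auto intro!: bounded_UN\<close>)
qed

text \<open>The real \<open>SUP\<close> dominates its family only if the family is bounded above;
  this supplies that condition for the running suprema in the growth and Lipschitz bounds.\<close>

lemma bdd_above_L2_set_path:
  assumes "\<And>i. i \<in> A \<Longrightarrow> cadlag T (\<lambda>t. x t i)" "t \<le> T"
  shows "bdd_above ((\<lambda>s. L2_set (x s) A) ` {0..t})"
proof -
  have "bounded ((\<lambda>s. L2_set (x s) A) ` {0..T})"
    using assms(1) by (intro cadlag_bounded cadlag_L2_set)
  then show ?thesis
    by (rule bounded_imp_bdd_above[OF bounded_subset]) (use assms(2) in auto)
qed

section \<open>Borel sets of the Skorokhod topology and evaluation of paths\<close>

lemma space_skorokhod_borel: "space (skorokhod_borel T A) = path_space T A"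
  unfolding skorokhod_borel_def
  by (intro space_measure_of) (auto simp: openin_skorokhod_topology)

lemma sets_skorokhod_borel:
  "sets (skorokhod_borel T A) =
    sigma_sets (path_space T A) {U. openin (skorokhod_topology T A) U}"
  unfolding skorokhod_borel_def
  by (intro sets_measure_of) (auto simp: openin_skorokhod_topology)

lemma pred_skorokhod_borelI:
  assumes "openin (skorokhod_topology T A) {x \<in> path_space T A. P x}"
  shows "Measurable.pred (skorokhod_borel T A) P"
  using assms unfolding pred_def space_skorokhod_borel sets_skorokhod_borel by blast

text \<open>The preimage of \<open>T\<close> lies at or before \<open>T\<close>, so monotonicity
  forces \<open>T \<le> \<tau> T\<close>.\<close>

lemma time_change_horizon:
  assumes "\<tau> \<in> time_changes T" "0 \<le> T"
  shows "\<tau> T = T"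
proof -
  from assms have b: "\<tau> ` {0..T} = {0..T}" and m: "strict_mono_on {0..T} \<tau>"
    by (auto simp: time_changes_def bij_betw_def)
  obtain u where u: "u \<in> {0..T}" "\<tau> u = T" using b assms(2) by (metis atLeastAtMost_iff imageE order_refl)
  have "\<tau> T \<in> {0..T}" using b assms(2) by auto
  moreover have "\<tau> u \<le> \<tau> T"
    using strict_mono_on_leD[OF m u(1), of T] u(1) by auto
  ultimately show ?thesis using u by auto
qed

text \<open>A time change carries a hit at \<open>s\<close> to a hit at \<open>\<tau> s\<close>. The
  strict inequalities in time and value leave slack, and the least of the three slacks serves as
  radius.\<close>

lemma openin_skorokhod_hitting:
  assumes "finite A" "i \<in> A"
  shows "openin (skorokhod_topology T A)
    {x \<in> path_space T A. \<exists>s\<in>{0..T}. p < s \<and> s < q \<and> x s i < c}"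
  unfolding openin_skorokhod_topology
proof (intro conjI ballI)
  fix x assume "x \<in> {x \<in> path_space T A. \<exists>s\<in>{0..T}. p < s \<and> s < q \<and> x s i < c}"
  then obtain s where s: "s \<in> {0..T}" "p < s" "s < q" "x s i < c" by blast
  define e where "e = min (c - x s i) (min (s - p) (q - s))"
  have "e > 0" using s by (simp add: e_def)
  moreover have "\<exists>s\<in>{0..T}. p < s \<and> s < q \<and> y s i < c" if y: "y \<in> skorokhod_ball T A x e" for y
  proof -
    obtain \<tau> where \<tau>: "\<tau> \<in> time_changes T" "\<bar>\<tau> s - s\<bar> < e" "L2_set (\<lambda>i. x s i - y (\<tau> s) i) A < e"
      using y s(1) unfolding skorokhod_ball_def by blast
    have "\<tau> s \<in> {0..T}" using \<tau>(1) s(1) by (auto simp: time_changes_def bij_betw_def)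
    moreover have "y (\<tau> s) i - x s i \<le> L2_set (\<lambda>i. x s i - y (\<tau> s) i) A"
      using member_le_L2_set[OF assms, of "\<lambda>i. y (\<tau> s) i - x s i"]
      by (simp add: L2_set_def power2_commute)
    ultimately show ?thesis using \<tau> by (intro bexI[of _ "\<tau> s"]) (auto simp: e_def)
  qed
  ultimately show "\<exists>e>0. skorokhod_ball T A x e \<subseteq>
      {x \<in> path_space T A. \<exists>s\<in>{0..T}. p < s \<and> s < q \<and> x s i < c}"
    unfolding skorokhod_ball_def by blast
qed auto

text \<open>Time changes fix \<open>T\<close>, so Skorokhod-close paths are close at
  \<open>T\<close>. This covers the one time whose value is not a right limit within
  \<open>[0,T]\<close>.\<close>

lemma openin_skorokhod_horizon:
  assumes "finite A" "i \<in> A" "0 \<le> T"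
  shows "openin (skorokhod_topology T A) {x \<in> path_space T A. x T i < c}"
  unfolding openin_skorokhod_topology
proof (intro conjI ballI)
  fix x assume x: "x \<in> {x \<in> path_space T A. x T i < c}"
  have "y T i < c" if y: "y \<in> skorokhod_ball T A x (c - x T i)" for y
  proof -
    obtain \<tau> where \<tau>: "\<tau> \<in> time_changes T" "L2_set (\<lambda>i. x T i - y (\<tau> T) i) A < c - x T i"
      using y assms(3) unfolding skorokhod_ball_def by (auto dest!: bspec[of _ _ T])
    have "y T i - x T i \<le> L2_set (\<lambda>i. x T i - y (\<tau> T) i) A"
      using member_le_L2_set[OF assms(1,2), of "\<lambda>i. y T i - x T i"] time_change_horizon[OF \<tau>(1) assms(3)]
      by (simp add: L2_set_def power2_commute)
    then show ?thesis using \<tau> by simp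
  qed
  with x show "\<exists>e>0. skorokhod_ball T A x e \<subseteq> {x \<in> path_space T A. x T i < c}"
    by (intro exI[of _ "c - x T i"]) (auto simp: skorokhod_ball_def)
qed auto

lemma le_iff_less_add_inverse: "r \<le> c \<longleftrightarrow> (\<forall>m::nat. r < c + 1 / Suc m)" for r c :: real
proof
  assume less: "\<forall>m::nat. r < c + 1 / Suc m"
  show "r \<le> c"
  proof (rule field_le_epsilon)
    fix e :: real assume "0 < e"
    then obtain m where "inverse (real (Suc m)) < e" using reals_Archimedean by blast
    with less[rule_format, of m] show "r \<le> c + e" by (simp add: inverse_eq_divide)
  qed
next
  assume "r \<le> c"
  then have "r < c + 1 / Suc m" for m :: nat by (rule le_less_trans) simp
  then show "\<forall>m::nat. r < c + 1 / Suc m" by blast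
qed

text \<open>This expresses an event at the single time \<open>t\<close> through hitting events on
  open intervals, which are open in the path. Right continuity gives hits near \<open>t\<close>;
  conversely, \<open>x t > c\<close> keeps \<open>x\<close> away from \<open>c\<close> just after
  \<open>t\<close>.\<close>

lemma right_limit_le_iff:
  fixes x :: "real \<Rightarrow> real"
  assumes "(x \<longlongrightarrow> x t) (at_right t)" "t < T" "0 \<le> t"
  shows "x t \<le> c \<longleftrightarrow>
    (\<forall>m::nat. \<exists>s\<in>{0..T}. t < s \<and> s < t + 1 / Suc m \<and> x s < c + 1 / Suc m)"
proof
  assume le: "x t \<le> c"
  show "\<forall>m::nat. \<exists>s\<in>{0..T}. t < s \<and> s < t + 1 / Suc m \<and> x s < c + 1 / Suc m"
  proof
    fix m :: nat
    have "\<forall>\<^sub>F s in at_right t. x s < c + 1 / Suc m"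
      using assms(1) le le_iff_less_add_inverse[of "x t" c] by (intro order_tendstoD(2)) auto
    moreover have "\<forall>\<^sub>F s in at_right t. s \<in> {t<..<min T (t + 1 / Suc m)}"
      using assms(2) by (intro eventually_at_right_real) auto
    ultimately have "\<forall>\<^sub>F s in at_right t. x s < c + 1 / Suc m \<and> s \<in> {t<..<min T (t + 1 / Suc m)}"
      by (rule eventually_conj)
    from eventually_happens'[OF trivial_limit_at_right_real this]
    obtain s where "x s < c + 1 / Suc m \<and> s \<in> {t<..<min T (t + 1 / Suc m)}" by blast
    then show "\<exists>s\<in>{0..T}. t < s \<and> s < t + 1 / Suc m \<and> x s < c + 1 / Suc m"
      using assms(3) by (intro bexI[of _ s]) auto
  qed
next
  assume hit: "\<forall>m::nat. \<exists>s\<in>{0..T}. t < s \<and> s < t + 1 / Suc m \<and> x s < c + 1 / Suc m"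
  show "x t \<le> c"
  proof (rule ccontr)
    assume "\<not> x t \<le> c"
    \<comment> \<open>Just after \<open>t\<close> the path stays above the midpoint of
      \<open>c\<close> and \<open>x t\<close>. A large \<open>m\<close> puts
      \<open>c + 1 / Suc m\<close> below that midpoint and the hitting time before \<open>b\<close>,
      a contradiction.\<close>
    then have "(x t + c) / 2 < x t" by simp
    from order_tendstoD(1)[OF assms(1) this] obtain b where
      b: "t < b" "\<And>s. t < s \<Longrightarrow> s < b \<Longrightarrow> (x t + c) / 2 < x s"
      by (auto simp: eventually_at_right_field)
    have "min (b - t) ((x t - c) / 2) > 0" using b \<open>\<not> x t \<le> c\<close> by simp
    then obtain m where m: "inverse (real (Suc m)) < min (b - t) ((x t - c) / 2)"
      using reals_Archimedean by blast
    obtain s where s: "t < s" "s < t + 1 / Suc m" "x s < c + 1 / Suc m" using hit by blast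
    have "s < b" using s m by (simp add: inverse_eq_divide)
    with b s have "(x t + c) / 2 < x s" by blast
    moreover have "1 / Suc m < (x t - c) / 2" using m by (simp add: inverse_eq_divide)
    ultimately show False using s(3) by argo
  qed
qed

text \<open>
  Evaluation at \<open>t < T\<close> is not continuous for the Skorokhod topology, but the condition that a
  coordinate drops below \<open>c\<close> somewhere in an open time interval is open, and by right
  continuity such conditions on \<open>(t, t + 1/m)\<close> determine the value at \<open>t\<close>.
\<close>

lemma borel_measurable_path_eval:
  assumes "finite A" "i \<in> A" "0 \<le> T"
  shows "(\<lambda>w. snd w (fst w) i) \<in>
    borel_measurable (restrict_space borel {0..T} \<Otimes>\<^sub>M skorokhod_borel T A)"
    (is "_ \<in> borel_measurable ?N")
  unfolding borel_measurable_iff_le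
proof
  fix c :: real
  have [measurable]: "Measurable.pred (skorokhod_borel T A)
      (\<lambda>x. \<exists>s\<in>{0..T}. p < s \<and> s < q \<and> x s i < c)" for p q c
    by (intro pred_skorokhod_borelI openin_skorokhod_hitting assms)
  have [measurable]: "Measurable.pred (skorokhod_borel T A) (\<lambda>x. x T i < c)" for c
    by (intro pred_skorokhod_borelI openin_skorokhod_horizon assms)
  have [measurable]: "(\<lambda>t. t) \<in> restrict_space borel {0..T} \<rightarrow>\<^sub>M borel"
    by (intro measurable_restrict_space1) simp
  have [measurable]: "fst \<in> borel_measurable ?N"
    by (rule measurable_compose[OF measurable_fst]) measurable
  \<comment> \<open>The hitting interval depends on the time \<open>fst w\<close>. Rational
    endpoints inside it decouple time from path: each disjunct combines a condition on time with a
    fixed open event on paths, and only countably many occur.\<close>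
  let ?P = "\<lambda>w. \<forall>m::nat.
      (fst w = T \<and> snd w T i < c + 1 / Suc m) \<or>
      (fst w < T \<and> (\<exists>p q :: rat. fst w < of_rat p \<and> of_rat q < fst w + 1 / Suc m \<and>
         (\<exists>s\<in>{0..T}. of_rat p < s \<and> s < of_rat q \<and> snd w s i < c + 1 / Suc m)))"
  have "snd w (fst w) i \<le> c \<longleftrightarrow> ?P w" if w: "w \<in> space ?N" for w
  proof -
    obtain t x where wt: "w = (t, x)" by fastforce
    have t: "t \<in> {0..T}" and x: "x \<in> path_space T A"
      using w by (auto simp: wt space_pair_measure space_skorokhod_borel)
    show ?thesis
    proof (cases "t = T")
      case True
      have "x T i \<le> c \<longleftrightarrow> (\<forall>m::nat. x T i < c + 1 / Suc m)" by (rule le_iff_less_add_inverse)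
      then show ?thesis using True by (simp add: wt)
    next
      case False
      with t have tT: "0 \<le> t" "t < T" by auto
      have "cadlag T (\<lambda>t. x t i)" using x assms(2) by (auto simp: path_space_def)
      then have "((\<lambda>t. x t i) \<longlongrightarrow> x t i) (at_right t)" using tT by (auto simp: cadlag_def)
      note right_limit_le_iff[OF this tT(2,1), of c]
      moreover have "(\<exists>s\<in>{0..T}. t < s \<and> s < u \<and> x s i < k) \<longleftrightarrow>
          (\<exists>p q :: rat. t < of_rat p \<and> of_rat q < u \<and>
            (\<exists>s\<in>{0..T}. of_rat p < s \<and> s < of_rat q \<and> x s i < k))" for u k
        by (meson less_trans of_rat_dense)
      ultimately show ?thesis using False tT by (simp add: wt)
    qed
  qed
  then have "{w \<in> space ?N. snd w (fst w) i \<le> c} = {w \<in> space ?N. ?P w}" by blast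
  also have "\<dots> \<in> sets ?N" by measurable
  finally show "{w \<in> space ?N. snd w (fst w) i \<le> c} \<in> sets ?N" .
qed

section \<open>Measurable dependence of a constant path on its value\<close>

text \<open>The hypothesis is openness in the maximum metric on extensional functions. Such a set is
  a union of boxes with rational corners, and for finite \<open>A\<close> there are only countably
  many of these.\<close>

lemma sets_PiM_borel_if_neighbourhoods:
  fixes P :: "('i \<Rightarrow> real) set"
  assumes "finite A" "P \<subseteq> A \<rightarrow>\<^sub>E UNIV"
    and "\<And>z. z \<in> P \<Longrightarrow> \<exists>e>0. \<forall>z'\<in>A \<rightarrow>\<^sub>E UNIV. (\<forall>i\<in>A. \<bar>z i - z' i\<bar> < e) \<longrightarrow> z' \<in> P"
  shows "P \<in> sets (PiM A (\<lambda>_. borel))"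
proof -
  define box where "box = (\<lambda>w. (A \<rightarrow>\<^sub>E UNIV) \<inter> (\<Pi> i\<in>A. {real_of_rat (fst w i)<..<of_rat (snd w i)}))"
  let ?R = "{w \<in> (A \<rightarrow>\<^sub>E UNIV) \<times> (A \<rightarrow>\<^sub>E UNIV). box w \<subseteq> P}"
  have "P \<subseteq> (\<Union>w\<in>?R. box w)"
  proof
    fix z assume z: "z \<in> P"
    obtain e where e: "e > 0" "\<forall>z'\<in>A \<rightarrow>\<^sub>E UNIV. (\<forall>i\<in>A. \<bar>z i - z' i\<bar> < e) \<longrightarrow> z' \<in> P"
      using assms(3)[OF z] by blast
    have "\<exists>p. z i - e < real_of_rat p \<and> of_rat p < z i" for i
      using of_rat_dense[of "z i - e" "z i"] e(1) by auto
    then obtain p where p: "\<And>i. z i - e < real_of_rat (p i)" "\<And>i. real_of_rat (p i) < z i" by metis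
    have "\<exists>q. z i < real_of_rat q \<and> of_rat q < z i + e" for i
      using of_rat_dense[of "z i" "z i + e"] e(1) by auto
    then obtain q where q: "\<And>i. z i < real_of_rat (q i)" "\<And>i. real_of_rat (q i) < z i + e" by metis
    \<comment> \<open>The corners lie within \<open>e\<close> of \<open>z\<close>, so the box stays
      in the neighbourhood. Restriction to \<open>A\<close> places them in the countable index set
      \<open>?R\<close>.\<close>
    let ?w = "(restrict p A, restrict q A)"
    have "box ?w \<subseteq> P"
    proof
      fix z' assume z': "z' \<in> box ?w"
      have "\<bar>z i - z' i\<bar> < e" if "i \<in> A" for i
      proof -
        have "z' i \<in> {real_of_rat (restrict p A i)<..<of_rat (restrict q A i)}"
          using z' that by (simp add: box_def Pi_iff)
        then have "real_of_rat (p i) < z' i" "z' i < of_rat (q i)" using that by simp_all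
        with p[of i] q[of i] show ?thesis by linarith
      qed
      with z' show "z' \<in> P" by (intro e(2)[rule_format]) (auto simp: box_def)
    qed
    moreover have "z \<in> box ?w" using z assms(2) p q by (auto simp: box_def)
    moreover have "?w \<in> (A \<rightarrow>\<^sub>E UNIV) \<times> (A \<rightarrow>\<^sub>E UNIV)" by auto
    ultimately show "z \<in> (\<Union>w\<in>?R. box w)" by (intro UN_I[of ?w]) simp_all
  qed
  then have P_eq: "P = (\<Union>w\<in>?R. box w)" by (intro equalityI) auto
  moreover have "countable ?R"
    using assms(1) by (intro countable_subset[OF _ countable_SIGMA[OF countable_PiE countable_PiE]]) auto
  moreover have "box w \<in> sets (PiM A (\<lambda>_. borel))" for w
  proof -
    have "box w = (\<Pi>\<^sub>E i\<in>A. {real_of_rat (fst w i)<..<of_rat (snd w i)})"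
      by (auto simp: box_def split_beta PiE_def)
    then show ?thesis using assms(1) by (auto intro!: sets_PiM_I_finite)
  qed
  ultimately have "(\<Union>w\<in>?R. box w) \<in> sets (PiM A (\<lambda>_. borel))"
    by (intro sets.countable_UN') auto
  with P_eq show ?thesis by (rule ssubst)
qed

definition const_path :: "real \<Rightarrow> ('i \<Rightarrow> real) \<Rightarrow> 'i path" where
  "const_path T z = (\<lambda>t\<in>{0..T}. z)"

lemma const_path_in_path_space: "z \<in> A \<rightarrow>\<^sub>E UNIV \<Longrightarrow> const_path T z \<in> path_space T A"
  unfolding path_space_def const_path_def
  using cadlag_cong[of T "\<lambda>t. restrict (\<lambda>t. z) {0..T} t _" "\<lambda>_. z _"]
  by (auto simp: cadlag_const)

text \<open>The map is continuous: the identity time change shows that constant paths with nearby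
  values are Skorokhod-close.\<close>

lemma measurable_const_path:
  assumes "finite A"
  shows "const_path T \<in> PiM A (\<lambda>_. borel) \<rightarrow>\<^sub>M skorokhod_borel T A"
  unfolding skorokhod_borel_def
proof (rule measurable_measure_of)
  show "{U. openin (skorokhod_topology T A) U} \<subseteq> Pow (path_space T A)"
    by (auto simp: openin_skorokhod_topology)
  show "const_path T \<in> space (PiM A (\<lambda>_. borel)) \<rightarrow> path_space T A"
    by (auto simp: space_PiM const_path_in_path_space)
  fix U assume "U \<in> {U. openin (skorokhod_topology T A) U}"
  then have U: "\<And>x. x \<in> U \<Longrightarrow> \<exists>e>0. skorokhod_ball T A x e \<subseteq> U"
    by (auto simp: openin_skorokhod_topology)
  show "const_path T -` U \<inter> space (PiM A (\<lambda>_. borel)) \<in> sets (PiM A (\<lambda>_. borel))"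
  proof (rule sets_PiM_borel_if_neighbourhoods[OF assms])
    fix z assume "z \<in> const_path T -` U \<inter> space (PiM A (\<lambda>_. borel))"
    then obtain e where e: "e > 0" "skorokhod_ball T A (const_path T z) e \<subseteq> U" using U by auto
    \<comment> \<open>The Euclidean norm is at most the sum of \<open>card A\<close> coordinate
      differences below \<open>r\<close>. The added 1 makes \<open>card A * r < e\<close> strict and
      covers empty \<open>A\<close>.\<close>
    define r where "r = e / (card A + 1)"
    have "const_path T z' \<in> U" if z': "z' \<in> A \<rightarrow>\<^sub>E UNIV" "\<forall>i\<in>A. \<bar>z i - z' i\<bar> < r" for z'
    proof -
      have "L2_set (\<lambda>i. z i - z' i) A \<le> (\<Sum>i\<in>A. \<bar>z i - z' i\<bar>)" by (rule L2_set_le_sum_abs)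
      also have "\<dots> \<le> card A * r" using z'(2) by (intro sum_bounded_above) auto
      also have "\<dots> < e" using e(1) by (simp add: r_def field_simps)
      finally have "L2_set (\<lambda>i. z i - z' i) A < e" .
      then have "const_path T z' \<in> skorokhod_ball T A (const_path T z) e"
        using e(1) const_path_in_path_space[OF z'(1), of T] unfolding skorokhod_ball_def
        by (simp, intro bexI[of _ "\<lambda>t. t"])
          (auto simp: time_changes_def const_path_def strict_mono_on_def bij_betw_def)
      with e(2) show ?thesis by blast
    qed
    then show "\<exists>e>0. \<forall>z'\<in>A \<rightarrow>\<^sub>E UNIV. (\<forall>i\<in>A. \<bar>z i - z' i\<bar> < e) \<longrightarrow>
        z' \<in> const_path T -` U \<inter> space (PiM A (\<lambda>_. borel))"
      using e(1) by (intro exI[of _ r]) (auto simp: space_PiM r_def)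
  qed (auto simp: space_PiM)
qed

section \<open>Merging coordinates and paths\<close>

lemma merge_in_PiE: "merge A C (x, y) \<in> (A \<union> C) \<rightarrow>\<^sub>E UNIV"
  by (auto simp: merge_def PiE_iff extensional_def)

lemma merge_paths_in_path_space:
  assumes "x \<in> path_space T A" "y \<in> path_space T C" "A \<inter> C = {}"
  shows "merge_paths T A C x y \<in> path_space T (A \<union> C)"
proof -
  have "cadlag T (\<lambda>t. merge_paths T A C x y t i)" if "i \<in> A \<union> C" for i
  proof (cases "i \<in> A")
    case True
    then have "cadlag T (\<lambda>t. x t i)" using assms by (auto simp: path_space_def)
    then show ?thesis
      using True by (subst cadlag_cong[where y="\<lambda>t. x t i"]) (auto simp: merge_paths_def merge_def)
  next
    case False
    then have "cadlag T (\<lambda>t. y t i)" "i \<in> C" using assms that by (auto simp: path_space_def)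
    then show ?thesis
      using assms(3) by (subst cadlag_cong[where y="\<lambda>t. y t i"]) (auto simp: merge_paths_def merge_def)
  qed
  then show ?thesis
    by (auto simp: path_space_def merge_paths_def PiE_iff extensional_def merge_def)
qed

lemma L2_set_merge_le:
  assumes "finite A" "finite C" "A \<inter> C = {}"
  shows "L2_set (merge A C (x, y)) (A \<union> C) \<le> L2_set x A + L2_set y C"
proof -
  have "(\<Sum>i\<in>A \<union> C. (merge A C (x, y) i)\<^sup>2) = (\<Sum>i\<in>A. (x i)\<^sup>2) + (\<Sum>i\<in>C. (y i)\<^sup>2)"
    using assms by (subst sum.union_disjoint) (auto intro!: arg_cong2[where f="(+)"] sum.cong)
  then show ?thesis
    unfolding L2_set_def by (metis sqrt_add_le_add_sqrt sum_nonneg zero_le_power2)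
qed

text \<open>The shared \<open>C\<close> coordinates cancel, so a Lipschitz bound in the full state
  becomes one in the \<open>A\<close> coordinates alone.\<close>

lemma L2_set_merge_diff:
  assumes "finite A" "finite C" "A \<inter> C = {}"
  shows "L2_set (\<lambda>i. merge A C (x, y) i - merge A C (x', y) i) (A \<union> C) = L2_set (\<lambda>i. x i - x' i) A"
proof -
  have "(\<Sum>i\<in>A \<union> C. (merge A C (x, y) i - merge A C (x', y) i)\<^sup>2) = (\<Sum>i\<in>A. (x i - x' i)\<^sup>2)"
    using assms by (subst sum.union_disjoint) auto
  then show ?thesis by (simp add: L2_set_def)
qed

section \<open>The drift as a function of time and state\<close>

text \<open>Bounds in running suprema become bounds in the current state, which can then be split by
  coordinates.\<close>

lemma linear_growth_lipschitz_pointwise: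
  fixes V :: "'i set"
  assumes L: "linear_growth_lipschitz T V {} V (\<lambda>t x y. \<mu> t (x t))" and T: "0 \<le> T"
  shows "\<exists>k. k \<in> borel_measurable (restrict_space borel {0..T}) \<and> cadlag T k \<and>
    (\<forall>t\<in>{0..T}. 0 < k t) \<and>
    (\<forall>t\<in>{0..T}. \<forall>z\<in>V \<rightarrow>\<^sub>E UNIV. L2_set (\<mu> t z) V \<le> k t * (1 + L2_set z V)) \<and>
    (\<forall>t\<in>{0..T}. \<forall>z\<in>V \<rightarrow>\<^sub>E UNIV. \<forall>z'\<in>V \<rightarrow>\<^sub>E UNIV.
      L2_set (\<lambda>j. \<mu> t z j - \<mu> t z' j) V \<le> k t * L2_set (\<lambda>i. z i - z' i) V)"
proof -
  \<comment> \<open>The unique point of \<open>path_space T {}\<close>; inserting it turns the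
    growth functional into a function of time.\<close>
  define o' :: "'i path" where "o' = const_path T (\<lambda>_. undefined)"
  have o': "o' \<in> path_space T {}" unfolding o'_def by (intro const_path_in_path_space) auto
  obtain K :: "real \<Rightarrow> 'i path \<Rightarrow> real" where K: "measurable_functional T {} K" "cadlag_functional T {} K"
    "\<forall>t\<in>{0..T}. \<forall>y\<in>path_space T {}. 0 < K t y"
    and growth: "\<forall>t\<in>{0..T}. \<forall>y\<in>path_space T {}. \<forall>x\<in>path_space T V.
      L2_set (\<mu> t (x t)) V \<le> K t y * (1 + (SUP s\<in>{0..t}. L2_set (x s) V))"
    and lip: "\<forall>t\<in>{0..T}. \<forall>y\<in>path_space T {}. \<forall>x\<^sub>1\<in>path_space T V. \<forall>x\<^sub>2\<in>path_space T V.
      L2_set (\<lambda>j. \<mu> t (x\<^sub>1 t) j - \<mu> t (x\<^sub>2 t) j) V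
        \<le> K t y * (SUP s\<in>{0..t}. L2_set (\<lambda>i. x\<^sub>1 s i - x\<^sub>2 s i) V)"
    using L[unfolded linear_growth_lipschitz_def, THEN conjunct2] by (elim exE conjE) (rule that)
  show ?thesis
  proof (intro exI[of _ "\<lambda>t. K t o'"] conjI ballI)
    have "(\<lambda>t. (t, o')) \<in> restrict_space borel {0..T} \<rightarrow>\<^sub>M
        restrict_space borel {0..T} \<Otimes>\<^sub>M skorokhod_borel T ({} :: 'i set)"
      using o' by (intro measurable_Pair measurable_const) (auto simp: space_skorokhod_borel)
    from measurable_compose[OF this K(1)[unfolded measurable_functional_def]]
    show "(\<lambda>t. K t o') \<in> borel_measurable (restrict_space borel {0..T})" by simp
    show "cadlag T (\<lambda>t. K t o')" using K(2) o' by (simp add: cadlag_functional_def)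
    show "0 < K t o'" if "t \<in> {0..T}" for t using K(3) that o' by blast
    fix t z assume t: "t \<in> {0..T}" and z: "z \<in> V \<rightarrow>\<^sub>E (UNIV :: real set)"
    have c: "const_path T z s = z" if "s \<in> {0..t}" for s and z :: "'i \<Rightarrow> real"
      using that t by (simp add: const_path_def)
    \<comment> \<open>Along a constant path the running supremum, over the nonempty set
      \<open>{0..t}\<close>, is the norm of the value.\<close>
    have s: "(SUP s\<in>{0..t}. L2_set (const_path T z s) V) = L2_set z V"
      using t c by (subst SUP_cong[OF refl, of _ _ "\<lambda>_. L2_set z V"]) auto
    show "L2_set (\<mu> t z) V \<le> K t o' * (1 + L2_set z V)"
      using growth[rule_format, OF t o' const_path_in_path_space[OF z]] t by (simp add: s c)
    fix z' assume z': "z' \<in> V \<rightarrow>\<^sub>E (UNIV :: real set)"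
    have s': "(SUP s\<in>{0..t}. L2_set (\<lambda>i. const_path T z s i - const_path T z' s i) V)
        = L2_set (\<lambda>i. z i - z' i) V"
      using t c by (subst SUP_cong[OF refl, of _ _ "\<lambda>_. L2_set (\<lambda>i. z i - z' i) V"]) auto
    show "L2_set (\<lambda>j. \<mu> t z j - \<mu> t z' j) V \<le> K t o' * L2_set (\<lambda>i. z i - z' i) V"
      using lip[rule_format, OF t o' const_path_in_path_space[OF z] const_path_in_path_space[OF z']] t
      by (simp add: s' c)
  qed
qed

text \<open>Measurability on path space is pulled back along
  \<open>(t, z) \<mapsto> (t, const_path T z, o')\<close>; at time \<open>t\<close> the constant
  path returns \<open>z\<close>.\<close>

lemma borel_measurable_drift:
  fixes V :: "'i set"
  assumes L: "linear_growth_lipschitz T V {} V (\<lambda>t x y. \<mu> t (x t))"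
    and "finite V" "v \<in> V"
  shows "(\<lambda>w. \<mu> (fst w) (snd w) v) \<in>
    borel_measurable (restrict_space borel {0..T} \<Otimes>\<^sub>M PiM V (\<lambda>_. borel))" (is "_ \<in> borel_measurable ?N")
proof -
  define o' :: "'i path" where "o' = const_path T (\<lambda>_. undefined)"
  have o': "o' \<in> path_space T {}" unfolding o'_def by (intro const_path_in_path_space) auto
  have "(\<lambda>w. (fst w, const_path T (snd w), o')) \<in> ?N \<rightarrow>\<^sub>M
      restrict_space borel {0..T} \<Otimes>\<^sub>M (skorokhod_borel T V \<Otimes>\<^sub>M skorokhod_borel T ({} :: 'i set))"
    using o' measurable_compose[OF measurable_snd measurable_const_path[OF assms(2)]]
    by (intro measurable_Pair measurable_fst measurable_const) (auto simp: space_skorokhod_borel)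
  moreover have "(\<lambda>(t, x, y). \<mu> t (x t) v) \<in> borel_measurable
      (restrict_space borel {0..T} \<Otimes>\<^sub>M (skorokhod_borel T V \<Otimes>\<^sub>M skorokhod_borel T ({} :: 'i set)))"
    using L assms(3) unfolding linear_growth_lipschitz_def by blast
  ultimately have "(\<lambda>w. \<mu> (fst w) (const_path T (snd w) (fst w)) v) \<in> borel_measurable ?N"
    by (auto dest: measurable_compose)
  then show ?thesis
    by (rule subst[OF measurable_cong, rotated])
      (auto simp: space_pair_measure const_path_def)
qed

section \<open>Growth and Lipschitz conditions for split arguments\<close>

text \<open>Merging is in general not continuous for the Skorokhod topologies, as the two paths may
  need different time changes. Each coordinate of the merged state, however, is an evaluation of one
  of the paths.\<close>

lemma borel_measurable_merge_path_eval:
  assumes "finite A" "finite C" "A \<inter> C = {}" "0 \<le> T"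
  shows "(\<lambda>(t, x, y). merge A C (x t, y t)) \<in>
    restrict_space borel {0..T} \<Otimes>\<^sub>M (skorokhod_borel T A \<Otimes>\<^sub>M skorokhod_borel T C) \<rightarrow>\<^sub>M
    PiM (A \<union> C) (\<lambda>_. borel)" (is "_ \<in> ?N \<rightarrow>\<^sub>M _")
proof (rule measurable_PiM_single')
  fix i assume i: "i \<in> A \<union> C"
  have A: "(\<lambda>w. (fst w, fst (snd w))) \<in> ?N \<rightarrow>\<^sub>M restrict_space borel {0..T} \<Otimes>\<^sub>M skorokhod_borel T A"
    and C: "(\<lambda>w. (fst w, snd (snd w))) \<in> ?N \<rightarrow>\<^sub>M restrict_space borel {0..T} \<Otimes>\<^sub>M skorokhod_borel T C"
    by measurable
  show "(\<lambda>w. (case w of (t, x, y) \<Rightarrow> merge A C (x t, y t)) i) \<in> borel_measurable ?N"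
  proof (cases "i \<in> A")
    case True
    from measurable_compose[OF A borel_measurable_path_eval[OF assms(1) this assms(4)]]
    show ?thesis using True by (simp add: split_beta' merge_def)
  next
    case False
    with i have "i \<in> C" by simp
    from measurable_compose[OF C borel_measurable_path_eval[OF assms(2) this assms(4)]]
    show ?thesis using False \<open>i \<in> C\<close> by (simp add: split_beta' merge_def)
  qed
qed (auto simp only: space_borel split_beta' intro!: merge_in_PiE)

lemma linear_growth_lipschitz_merge_paths:
  assumes L: "linear_growth_lipschitz T (A \<union> C) {} (A \<union> C) (\<lambda>t x y. \<mu> t (x t))"
    and fin: "finite A" "finite C" "finite H" and disj: "A \<inter> C = {}" and T: "0 \<le> T"
    and v: "v \<in> A \<union> C"
    and g_None: "\<And>t x. t \<in> {0..T} \<Longrightarrow> x \<in> path_space T (A \<union> C) \<Longrightarrow> g t x None = \<mu> t (x t) v"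
    and g_Some: "\<And>t x w. t \<in> {0..T} \<Longrightarrow> x \<in> path_space T (A \<union> C) \<Longrightarrow> w \<in> H \<Longrightarrow> g t x (Some w) = q w"
  shows "linear_growth_lipschitz T A C (insert None (Some ` H)) (\<lambda>t x y. g t (merge_paths T A C x y))"
  unfolding linear_growth_lipschitz_def
proof (intro conjI)
  let ?J = "insert None (Some ` H)"
  let ?N = "restrict_space borel {0..T} \<Otimes>\<^sub>M (skorokhod_borel T A \<Otimes>\<^sub>M skorokhod_borel T C)"
  let ?m = "merge_paths T A C"
  have m_eval: "?m x y t = merge A C (x t, y t)" if "t \<in> {0..T}" for x y t
    using that by (simp add: merge_paths_def)
  have None_eq: "g t (?m x y) None = \<mu> t (merge A C (x t, y t)) v"
    and Some_eq: "w \<in> H \<Longrightarrow> g t (?m x y) (Some w) = q w"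
    if "t \<in> {0..T}" "x \<in> path_space T A" "y \<in> path_space T C" for t x y w
    using that g_None g_Some merge_paths_in_path_space[OF that(2,3) disj] m_eval by auto
  show "\<forall>j\<in>?J. (\<lambda>(t, x, y). g t (?m x y) j) \<in> borel_measurable ?N"
  proof
    fix j assume "j \<in> ?J"
    then consider "j = None" | w where "w \<in> H" "j = Some w" by blast
    then show "(\<lambda>(t, x, y). g t (?m x y) j) \<in> borel_measurable ?N"
    proof cases
      case 1
      \<comment> \<open>The drift coordinate is \<open>(t, z) \<mapsto> \<mu> t z v\<close> composed
        with time and merged state.\<close>
      have "(\<lambda>w. (fst w, case w of (t, x, y) \<Rightarrow> merge A C (x t, y t))) \<in> ?N \<rightarrow>\<^sub>M
          restrict_space borel {0..T} \<Otimes>\<^sub>M PiM (A \<union> C) (\<lambda>_. borel)"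
        using borel_measurable_merge_path_eval[OF fin(1,2) disj T]
        by (intro measurable_Pair measurable_fst)
      from measurable_compose[OF this borel_measurable_drift[OF L _ v]] fin
      have "(\<lambda>(t, x, y). \<mu> t (merge A C (x t, y t)) v) \<in> borel_measurable ?N"
        by (simp add: split_beta')
      then show ?thesis
        by (rule subst[OF measurable_cong, rotated])
          (auto simp: 1 space_pair_measure space_skorokhod_borel None_eq)
    next
      case 2
      have "(\<lambda>_. q w) \<in> borel_measurable ?N" by simp
      then show ?thesis
        by (rule subst[OF measurable_cong, rotated])
          (auto simp: 2 space_pair_measure space_skorokhod_borel Some_eq)
    qed
  qed
  obtain k where k: "k \<in> borel_measurable (restrict_space borel {0..T})" "cadlag T k"
    and k_pos: "\<forall>t\<in>{0..T}. 0 < k t"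
    and growth: "\<forall>t\<in>{0..T}. \<forall>z\<in>(A \<union> C) \<rightarrow>\<^sub>E UNIV.
      L2_set (\<mu> t z) (A \<union> C) \<le> k t * (1 + L2_set z (A \<union> C))"
    and lip: "\<forall>t\<in>{0..T}. \<forall>z\<in>(A \<union> C) \<rightarrow>\<^sub>E UNIV. \<forall>z'\<in>(A \<union> C) \<rightarrow>\<^sub>E UNIV.
      L2_set (\<lambda>j. \<mu> t z j - \<mu> t z' j) (A \<union> C) \<le> k t * L2_set (\<lambda>i. z i - z' i) (A \<union> C)"
    using linear_growth_lipschitz_pointwise[OF L T] by (elim exE conjE) (rule that)
  define \<sigma> where "\<sigma> = (\<Sum>w\<in>H. \<bar>q w\<bar>)"
  have \<sigma>: "0 \<le> \<sigma>" by (simp add: \<sigma>_def sum_nonneg)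
  \<comment> \<open>The factor \<open>1 + L2_set (y t) C\<close> absorbs the given coordinates and
    \<open>\<sigma>\<close> the constant noise coefficients. Since \<open>k t \<le> K t y\<close>,
    the same \<open>K\<close> serves the Lipschitz bound.\<close>
  define K :: "real \<Rightarrow> 'a path \<Rightarrow> real" where "K = (\<lambda>t y. k t * (1 + L2_set (y t) C) + \<sigma>)"
  have k_le_K: "k t \<le> K t y" if "t \<in> {0..T}" for t y
    using k_pos[rule_format, OF that] \<sigma> by (simp add: K_def distrib_left)
  \<comment> \<open>The hypothesis is coordinatewise because this is also applied to a difference of
    paths, which may fail to be undefined off \<open>A\<close> and so to lie in
    \<open>path_space T A\<close>.\<close>
  have le_SUP: "L2_set (x t) A \<le> (SUP s\<in>{0..t}. L2_set (x s) A)"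
    if "t \<in> {0..T}" "\<And>i. i \<in> A \<Longrightarrow> cadlag T (\<lambda>t. x t i)" for t and x :: "'a path"
    using that by (intro cSUP_upper bdd_above_L2_set_path[where T=T]) auto
  have cadlag_coord: "cadlag T (\<lambda>t. x t i)" if "x \<in> path_space T B" "i \<in> B" for x :: "'a path" and B i
    using that by (auto simp: path_space_def)
  have L2_J: "L2_set u ?J \<le> \<bar>u None\<bar> + (\<Sum>w\<in>H. \<bar>u (Some w)\<bar>)" for u :: "'b option \<Rightarrow> real"
    using L2_set_le_sum_abs[of u ?J] fin(3) by (simp add: sum.reindex)
  have K_measurable: "measurable_functional T C K"
  proof -
    let ?M = "restrict_space borel {0..T} \<Otimes>\<^sub>M skorokhod_borel T C"
    have [measurable]: "(\<lambda>w. snd w (fst w) i) \<in> borel_measurable ?M" if "i \<in> C" for i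
      using that fin T by (intro borel_measurable_path_eval)
    have [measurable]: "(\<lambda>w. k (fst w)) \<in> borel_measurable ?M"
      by (rule measurable_compose[OF measurable_fst k(1)])
    have "(\<lambda>w. k (fst w) * (1 + L2_set (snd w (fst w)) C) + \<sigma>) \<in> borel_measurable ?M"
      unfolding L2_set_def by measurable
    then show ?thesis by (simp add: measurable_functional_def K_def split_beta')
  qed
  have K_cadlag: "cadlag_functional T C K"
    unfolding cadlag_functional_def K_def
    by (intro ballI cadlag_add cadlag_mult cadlag_const k(2) cadlag_L2_set cadlag_coord)
  have K_pos: "0 < K t y" if "t \<in> {0..T}" for t y
    using k_pos[rule_format, OF that] k_le_K[OF that] by (rule less_le_trans)
  have K_growth: "L2_set (g t (?m x y)) ?J \<le> K t y * (1 + (SUP s\<in>{0..t}. L2_set (x s) A))"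
    if t: "t \<in> {0..T}" and y: "y \<in> path_space T C" and x: "x \<in> path_space T A" for t x y
  proof -
    let ?z = "merge A C (x t, y t)"
    let ?S = "SUP s\<in>{0..t}. L2_set (x s) A"
    have S: "L2_set (x t) A \<le> ?S" using x t by (intro le_SUP cadlag_coord)
    then have S0: "0 \<le> ?S" using L2_set_nonneg order_trans by blast
    have J: "L2_set (g t (?m x y)) ?J \<le> \<bar>\<mu> t ?z v\<bar> + \<sigma>"
      using L2_J[of "g t (?m x y)"] None_eq[OF t x y] Some_eq[OF t x y] by (simp add: \<sigma>_def)
    have "\<bar>\<mu> t ?z v\<bar> \<le> L2_set (\<lambda>i. \<bar>\<mu> t ?z i\<bar>) (A \<union> C)"
      using fin v by (intro member_le_L2_set) auto
    also have "\<dots> = L2_set (\<mu> t ?z) (A \<union> C)" by (simp add: L2_set_def)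
    also have "\<dots> \<le> k t * (1 + L2_set ?z (A \<union> C))" by (rule growth[rule_format, OF t merge_in_PiE])
    also have "\<dots> \<le> k t * (1 + (?S + L2_set (y t) C))"
      using L2_set_merge_le[OF fin(1,2) disj, of "x t" "y t"] S k_pos[rule_format, OF t]
      by (intro mult_left_mono) auto
    \<comment> \<open>For nonnegative \<open>p\<close> and \<open>q\<close>,
      \<open>1 + p + q \<le> (1 + p) * (1 + q)\<close>; this separates the dependence on
      \<open>y\<close> from that on \<open>x\<close>.\<close>
    also have "\<dots> \<le> k t * ((1 + L2_set (y t) C) * (1 + ?S))"
      using S0 k_pos[rule_format, OF t] by (intro mult_left_mono) (auto simp: algebra_simps)
    finally have "\<bar>\<mu> t ?z v\<bar> \<le> k t * ((1 + L2_set (y t) C) * (1 + ?S))" .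
    moreover have "\<sigma> \<le> \<sigma> * (1 + ?S)" using \<sigma> S0 by (simp add: distrib_left)
    ultimately have "L2_set (g t (?m x y)) ?J
        \<le> k t * ((1 + L2_set (y t) C) * (1 + ?S)) + \<sigma> * (1 + ?S)"
      using J by linarith
    also have "\<dots> = K t y * (1 + ?S)" by (simp only: K_def distrib_right mult.assoc)
    finally show ?thesis .
  qed
  have K_lipschitz: "L2_set (\<lambda>j. g t (?m x\<^sub>1 y) j - g t (?m x\<^sub>2 y) j) ?J
      \<le> K t y * (SUP s\<in>{0..t}. L2_set (\<lambda>i. x\<^sub>1 s i - x\<^sub>2 s i) A)"
    if t: "t \<in> {0..T}" and y: "y \<in> path_space T C"
      and x: "x\<^sub>1 \<in> path_space T A" "x\<^sub>2 \<in> path_space T A" for t x\<^sub>1 x\<^sub>2 y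
  proof -
    let ?z1 = "merge A C (x\<^sub>1 t, y t)" and ?z2 = "merge A C (x\<^sub>2 t, y t)"
    let ?S = "SUP s\<in>{0..t}. L2_set (\<lambda>i. x\<^sub>1 s i - x\<^sub>2 s i) A"
    have "cadlag T (\<lambda>t. x\<^sub>1 t i - x\<^sub>2 t i)" if "i \<in> A" for i
      using cadlag_add[OF cadlag_coord[OF x(1) that]
          cadlag_mult[OF cadlag_const[of T "-1"] cadlag_coord[OF x(2) that]]] by simp
    then have S: "L2_set (\<lambda>i. x\<^sub>1 t i - x\<^sub>2 t i) A \<le> ?S"
      using t le_SUP[of t "\<lambda>s i. x\<^sub>1 s i - x\<^sub>2 s i"] by blast
    then have S0: "0 \<le> ?S" using L2_set_nonneg order_trans by blast
    \<comment> \<open>The noise coordinates equal \<open>q w\<close> for both paths and cancel,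
      leaving only the drift coordinate.\<close>
    have "L2_set (\<lambda>j. g t (?m x\<^sub>1 y) j - g t (?m x\<^sub>2 y) j) ?J \<le> \<bar>\<mu> t ?z1 v - \<mu> t ?z2 v\<bar>"
      using L2_J[of "\<lambda>j. g t (?m x\<^sub>1 y) j - g t (?m x\<^sub>2 y) j"]
        None_eq[OF t x(1) y] None_eq[OF t x(2) y] Some_eq[OF t x(1) y] Some_eq[OF t x(2) y]
      by simp
    also have "\<dots> \<le> L2_set (\<lambda>i. \<bar>\<mu> t ?z1 i - \<mu> t ?z2 i\<bar>) (A \<union> C)"
      using fin v by (intro member_le_L2_set) auto
    also have "\<dots> = L2_set (\<lambda>i. \<mu> t ?z1 i - \<mu> t ?z2 i) (A \<union> C)" by (simp add: L2_set_def)
    also have "\<dots> \<le> k t * L2_set (\<lambda>i. ?z1 i - ?z2 i) (A \<union> C)"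
      by (rule lip[rule_format, OF t merge_in_PiE merge_in_PiE])
    also have "\<dots> = k t * L2_set (\<lambda>i. x\<^sub>1 t i - x\<^sub>2 t i) A"
      using fin disj by (simp add: L2_set_merge_diff)
    also have "\<dots> \<le> K t y * ?S"
      using k_pos[rule_format, OF t] k_le_K[OF t, of y] S S0 by (intro mult_mono) auto
    finally show ?thesis .
  qed
  show "\<exists>K. measurable_functional T C K \<and> cadlag_functional T C K \<and>
        (\<forall>t\<in>{0..T}. \<forall>y\<in>path_space T C. 0 < K t y) \<and>
        (\<forall>t\<in>{0..T}. \<forall>y\<in>path_space T C. \<forall>x\<in>path_space T A.
           L2_set (g t (?m x y)) ?J \<le> K t y * (1 + (SUP s\<in>{0..t}. L2_set (x s) A))) \<and>
        (\<forall>t\<in>{0..T}. \<forall>y\<in>path_space T C. \<forall>x\<^sub>1\<in>path_space T A. \<forall>x\<^sub>2\<in>path_space T A.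
           L2_set (\<lambda>j. g t (?m x\<^sub>1 y) j - g t (?m x\<^sub>2 y) j) ?J
             \<le> K t y * (SUP s\<in>{0..t}. L2_set (\<lambda>i. x\<^sub>1 s i - x\<^sub>2 s i) A))"
    by (intro exI[of _ K] conjI ballI)
      (assumption | rule K_measurable K_cadlag K_pos K_growth K_lipschitz)+
qed

section \<open>Components of the causal graph and the two conditions\<close>

lemma causal_components_subset_endo:
  assumes "S \<in> causal_components T D"
  shows "S \<subseteq> endo D"
proof -
  interpret G: wf_digraph "causal_graph T D"
    by unfold_locales (auto simp: causal_graph_def causal_edge_def)
  show ?thesis
    using G.sccs_verts_subsets[of S] assms unfolding G.sccs_verts_conv
    by (simp add: causal_graph_def)
qed

theorem mainTheorem3:
  fixes M :: "'w measure" and F :: "real \<Rightarrow> 'w measure" and T :: real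
    and D :: "('i, 'i option, 'w) causal_sde"
    and d :: nat and I B :: "'i set" and a :: "'i \<Rightarrow> 'i" and X0 :: "'i \<Rightarrow> 'w \<Rightarrow> real"
    and \<mu> :: "real \<Rightarrow> ('i \<Rightarrow> real) \<Rightarrow> 'i \<Rightarrow> real" and Q :: "'i \<Rightarrow> 'i \<Rightarrow> real"
  assumes "additive_noise_system M F T D d I B a X0 \<mu> Q"
  shows "(\<forall>S\<in>causal_components T D. \<forall>v\<in>S. alpha D v \<inter> S = {}) \<and>
    (\<forall>v\<in>endo D.
       let S = component_of T D v;
           A = insert v (beta D v \<inter> S);
           C = beta D v - S
       in linear_growth_lipschitz T A C (coords D v)
            (\<lambda>t x y. integrand D v t (merge_paths T A C x y)))"
proof -
  interpret additive_noise_system M F T D d I B a X0 \<mu> Q by (rule assms)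
  \<comment> \<open>Components contain only endogenous indices, whereas \<open>a v\<close> belongs
    to \<open>I\<close> and is exogenous.\<close>
  have "alpha D v \<inter> S = {}" if S: "S \<in> causal_components T D" and "v \<in> S" for S v
  proof -
    have "S \<subseteq> endo D" using S by (rule causal_components_subset_endo)
    moreover have "v \<in> endo D" using calculation \<open>v \<in> S\<close> by blast
    moreover have "a v \<in> exo D" using a_bij \<open>v \<in> endo D\<close> exo_eq by (auto simp: bij_betw_def)
    ultimately show ?thesis using endo_exo_disjoint by (auto simp: alpha_eq)
  qed
  moreover have "linear_growth_lipschitz T (insert v (beta D v \<inter> S)) (beta D v - S) (coords D v)
      (\<lambda>t x y. integrand D v t
        (merge_paths T (insert v (beta D v \<inter> S)) (beta D v - S) x y))"
    if v: "v \<in> endo D" for v S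
  proof -
    \<comment> \<open>Since \<open>beta D v\<close> is \<open>endo D\<close> without
      \<open>v\<close>, the two blocks partition \<open>endo D\<close> for any \<open>S\<close>. The
      drift hypothesis thus applies to their union, and the component of \<open>v\<close> is one
      instance.\<close>
    have Un: "insert v (beta D v \<inter> S) \<union> (beta D v - S) = endo D"
      and ins: "insert v (beta D v) = endo D"
      using v by (auto simp: beta_eq)
    show ?thesis
      unfolding coords_eq[OF v]
    proof (rule linear_growth_lipschitz_merge_paths[where \<mu>=\<mu> and v=v and q="Q v"])
      show "finite (gamma D v)"
        using gamma_subset[OF v] finite_exo by (rule finite_subset)
      show "insert v (beta D v \<inter> S) \<inter> (beta D v - S) = {}" using v by (auto simp: beta_eq)
      show "linear_growth_lipschitz T (insert v (beta D v \<inter> S) \<union> (beta D v - S)) {}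
          (insert v (beta D v \<inter> S) \<union> (beta D v - S)) (\<lambda>t x y. \<mu> t (x t))"
        unfolding Un by (rule drift_lipschitz)
      show "finite (insert v (beta D v \<inter> S))" "finite (beta D v - S)"
        using v finite_endo by (simp_all add: beta_eq)
      show "v \<in> insert v (beta D v \<inter> S) \<union> (beta D v - S)" by simp
      show "0 \<le> T" by (rule horizon_nonneg)
    next
      fix t x assume "t \<in> {0..T}" "x \<in> path_space T (insert v (beta D v \<inter> S) \<union> (beta D v - S))"
      then show "integrand D v t x None = \<mu> t (x t) v"
        unfolding Un ins[symmetric] by (rule integrand_None[OF v])
    next
      fix t x w assume "t \<in> {0..T}" "x \<in> path_space T (insert v (beta D v \<inter> S) \<union> (beta D v - S))"
        "w \<in> gamma D v"
      then show "integrand D v t x (Some w) = Q v w"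
        unfolding Un ins[symmetric] by (rule integrand_Some[OF v])
    qed
  qed
  ultimately show ?thesis by (simp add: Let_def)
qed

end
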